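(* Let $0<\alpha<1$, $L>0$, $T>0$, $\nu>0$, let $u_0$ be a sufficiently smooth function on $[0,L]$, and let $u(x,t)$ be a classical solution of the time-fractional Burgers equation $$\partial^\alpha_{+0,t}u+uu_x=\nu u_{xx},\quad x\in(0,L),\ t>0,\qquad u(x,0)=u_0(x),\ x\in[0,L].$$ Then $$u(x,t)\ge\min_{(x,t)}\{u(0,t),\,u(L,t),\,u_0(x)\}\quad\text{for }(x,t)\in[0,L]\times[0,T),$$ where the minimum is taken over all the values $u(0,t)$, $u(L,t)$ with $t\in[0,T)$ and $u_0(x)$ with $x\in[0,L]$.
   Context: $\partial_{+0,t}^\alpha$ is the Caputo derivative of order $\alpha\in(0,1)$ in $t$: $\partial_{+0}^\alpha f(t)=\frac{d}{dt}\frac{1}{\Gamma(1-\alpha)}\int_0^t(t-s)^{-\alpha}(f(s)-f(0))\,ds$, which for $f\in C^1$ equals $\frac{1}{\Gamma(1-\alpha)}\int_0^t(t-s)^{-\alpha}f'(s)\,ds$. A classical solution is one that is continuous up to the boundary, continuously differentiable in $t$ and twice continuously differentiable in $x$, satisfying the equation pointwise. *)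

theory Defs
  imports "HOL-Analysis.Analysis"
begin

(* The Caputo derivative of order \<alpha> in the form that needs no derivative of f at 0.
   It is a relation, like has_real_derivative, so that a statement about it includes existence.
   The value 0 of the kernel at s = \<tau> (0 powr a = 0) does not affect the integral. *)
definition has_caputo_derivative :: "real \<Rightarrow> (real \<Rightarrow> real) \<Rightarrow> real \<Rightarrow> real \<Rightarrow> bool" where
  "has_caputo_derivative \<alpha> f D t \<longleftrightarrow>
     ((\<lambda>\<tau>. 1 / Gamma (1 - \<alpha>) *
        integral {0..\<tau>} (\<lambda>s. (\<tau> - s) powr (- \<alpha>) * (f s - f 0)))
      has_real_derivative D) (at t)"

(* u x t is a classical solution on [0,L] x [0,T): the derivatives ut, ux, uxx exist and are
   jointly continuous only in the open set (0,L) x (0,T); in particular nothing is required of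
   ut as t tends to 0, where solutions typically behave like t powr \<alpha>. *)
definition classical_solution_fractional_burgers ::
  "real \<Rightarrow> real \<Rightarrow> real \<Rightarrow> real \<Rightarrow> (real \<Rightarrow> real) \<Rightarrow> (real \<Rightarrow> real \<Rightarrow> real) \<Rightarrow> bool" where
  "classical_solution_fractional_burgers \<alpha> \<nu> L T u\<^sub>0 u \<longleftrightarrow>
     continuous_on ({0..L} \<times> {0..<T}) (\<lambda>(x, t). u x t) \<and>
     (\<exists>ut ux uxx.
        continuous_on ({0<..<L} \<times> {0<..<T}) (\<lambda>(x, t). ut x t) \<and>
        continuous_on ({0<..<L} \<times> {0<..<T}) (\<lambda>(x, t). ux x t) \<and>
        continuous_on ({0<..<L} \<times> {0<..<T}) (\<lambda>(x, t). uxx x t) \<and>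
        (\<forall>x\<in>{0<..<L}. \<forall>t\<in>{0<..<T}.
           ((\<lambda>s. u x s) has_real_derivative ut x t) (at t) \<and>
           ((\<lambda>y. u y t) has_real_derivative ux x t) (at x) \<and>
           ((\<lambda>y. ux y t) has_real_derivative uxx x t) (at x) \<and>
           (\<exists>D. has_caputo_derivative \<alpha> (\<lambda>s. u x s) D t \<and>
                D + u x t * ux x t = \<nu> * uxx x t))) \<and>
     (\<forall>x\<in>{0..L}. u x 0 = u\<^sub>0 x)"

(* The minimum need not be attained on the half-open time interval, and the boundary values may be
   unbounded below as t tends to T, so it is read as the infimum in the extended reals. *)
definition min_data ::
  "real \<Rightarrow> real \<Rightarrow> (real \<Rightarrow> real) \<Rightarrow> (real \<Rightarrow> real \<Rightarrow> real) \<Rightarrow> ereal" where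
  "min_data L T u\<^sub>0 u =
     Inf (ereal ` ((\<lambda>t. u 0 t) ` {0..<T} \<union> (\<lambda>t. u L t) ` {0..<T} \<union> u\<^sub>0 ` {0..L}))"

end

theory Submission
  imports Defs
begin

text \<open>If \<open>u\<close> fell below the data, its minimum over a rectangle \<open>[0,L] \<times> [0,t]\<close> would be
  attained at some \<open>(x\<^sub>0, t\<^sub>0)\<close> with \<open>0 < x\<^sub>0 < L\<close> and \<open>t\<^sub>0 > 0\<close>. There \<open>u\<^sub>x = 0\<close> and \<open>u\<^sub>x\<^sub>x \<ge> 0\<close>,
  so the equation makes the Caputo derivative nonnegative. But at a minimum over \<open>[0,t\<^sub>0]\<close> with a
  value strictly below the initial one the Caputo derivative is strictly negative. The latter is
  read off the left difference quotients of the fractional integral: for \<open>w = f - f(t\<^sub>0) \<ge> 0\<close>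
  the kernel \<open>(\<tau> - s) powr (-\<alpha>)\<close> decreases in \<open>\<tau>\<close>, and the only positive contribution, from
  \<open>s\<close> in \<open>[\<tau>, t\<^sub>0]\<close>, is \<open>O((t\<^sub>0 - \<tau>) powr (2-\<alpha>))\<close> because \<open>w\<close> vanishes at \<open>t\<^sub>0\<close> to first order.\<close>

lemma has_integral_powr_reflected:
  fixes \<alpha> a b :: real
  assumes "\<alpha> < 1" "a \<le> b"
  shows "((\<lambda>s. (b - s) powr (-\<alpha>)) has_integral ((b - a) powr (1 - \<alpha>) / (1 - \<alpha>))) {a..b}"
proof -
  let ?F = "\<lambda>s. - ((b - s) powr (1 - \<alpha>) / (1 - \<alpha>))"
  have "((\<lambda>s. (b - s) powr (-\<alpha>)) has_integral (?F b - ?F a)) {a..b}"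
  \<comment> \<open>For \<alpha> > 0 the integrand blows up at \<open>b\<close>, where
    \<open>?F\<close> is merely continuous; hence the version that asks for the derivative only in
    the open interval.\<close>
  proof (rule fundamental_theorem_of_calculus_interior)
    show "continuous_on {a..b} ?F"
      using assms by (intro continuous_on_minus continuous_on_divide continuous_on_powr' continuous_intros) auto
    fix s assume "s \<in> {a<..<b}"
    then have "((\<lambda>s. (b - s) powr (1 - \<alpha>)) has_real_derivative
        (1 - \<alpha>) * (b - s) powr (1 - \<alpha> - of_nat 1) * (-1)) (at s)"
      by (intro DERIV_fun_powr) (auto intro!: derivative_eq_intros)
    from DERIV_minus[OF DERIV_cdivide[OF this, of "1 - \<alpha>"]]
    show "(?F has_vector_derivative (b - s) powr (-\<alpha>)) (at s)"
      unfolding has_real_derivative_iff_has_vector_derivative[symmetric]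
      using assms by simp
  qed (use assms in auto)
  then show ?thesis
    using assms by simp
qed

text \<open>The kernel is nonnegative and integrable, hence absolutely integrable, and a continuous
  \<open>w\<close> is bounded and measurable on a compact interval.\<close>

lemma integrable_powr_reflected_mult:
  fixes \<alpha> a b :: real
  assumes "\<alpha> < 1" "continuous_on {a..b} w"
  shows "(\<lambda>s. (b - s) powr (-\<alpha>) * w s) integrable_on {a..b}"
proof (cases "a \<le> b")
  case True
  have "(\<lambda>s. (b - s) powr (-\<alpha>)) absolutely_integrable_on {a..b}"
    using has_integral_powr_reflected[OF assms(1) True]
    by (intro nonnegative_absolutely_integrable_1) (auto simp: integrable_on_def)
  moreover have "w \<in> borel_measurable (lebesgue_on {a..b})"
    by (intro continuous_imp_measurable_on_sets_lebesgue assms) auto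
  moreover have "bounded (w ` {a..b})"
    by (intro compact_imp_bounded compact_continuous_image assms) auto
  ultimately have "(\<lambda>s. w s * (b - s) powr (-\<alpha>)) absolutely_integrable_on {a..b}"
    by (intro absolutely_integrable_bounded_measurable_product_real) auto
  then show ?thesis
    by (simp add: absolutely_integrable_on_def mult.commute)
qed auto

text \<open>Split the integral at \<tau>: on \<open>{0..\<tau>}\<close> moving the upper end from
  \<tau> to \<open>t\<close> does not increase the kernel, and on \<open>{\<tau>..t}\<close> the
  integrand is at most \<open>K\<close> times the kernel. As \<open>K\<close> may depend on \<tau>,
  smallness of \<open>w\<close> near \<open>t\<close> can be exploited.\<close>

lemma powr_reflected_integral_increment_le:
  fixes \<alpha> K \<tau> t :: real
  assumes "0 \<le> \<alpha>" "\<alpha> < 1" "0 \<le> \<tau>" "\<tau> \<le> t" and cont: "continuous_on {0..t} w"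
    and nonneg: "\<And>s. s \<in> {0..t} \<Longrightarrow> 0 \<le> w s"
    and le: "\<And>s. s \<in> {\<tau>..t} \<Longrightarrow> w s \<le> K"
  shows "integral {0..t} (\<lambda>s. (t - s) powr (-\<alpha>) * w s)
     - integral {0..\<tau>} (\<lambda>s. (\<tau> - s) powr (-\<alpha>) * w s) \<le> K * (t - \<tau>) powr (1 - \<alpha>) / (1 - \<alpha>)"
proof -
  let ?k = "\<lambda>s. (t - s) powr (-\<alpha>) * w s"
  have int: "?k integrable_on {0..t}"
    using assms by (intro integrable_powr_reflected_mult)
  have int1: "?k integrable_on {0..\<tau>}" and int2: "?k integrable_on {\<tau>..t}"
    using assms by (auto intro: integrable_subinterval_real[OF int])
  have int\<tau>: "(\<lambda>s. (\<tau> - s) powr (-\<alpha>) * w s) integrable_on {0..\<tau>}"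
    using assms by (intro integrable_powr_reflected_mult continuous_on_subset[OF cont]) auto
  have "integral {0..\<tau>} ?k \<le> integral {0..\<tau>} (\<lambda>s. (\<tau> - s) powr (-\<alpha>) * w s)"
  proof (rule integral_le[THEN order_trans, OF _ _ _ eq_refl])
    \<comment> \<open>The kernel vanishes at \<open>s = \<tau>\<close>, where monotonicity fails; a spike handles that point.\<close>
    let ?m = "\<lambda>s. if s = \<tau> then ?k \<tau> else (\<tau> - s) powr (-\<alpha>) * w s"
    show "?k integrable_on {0..\<tau>}" by fact
    show "?m integrable_on {0..\<tau>}"
      by (rule integrable_spike_finite[OF _ _ int\<tau>, of "{\<tau>}"]) auto
    show "?k s \<le> ?m s" if "s \<in> {0..\<tau>}" for s
      using that assms by (auto intro!: mult_right_mono powr_mono2')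
    show "integral {0..\<tau>} ?m = integral {0..\<tau>} (\<lambda>s. (\<tau> - s) powr (-\<alpha>) * w s)"
      by (rule integral_spike[of "{\<tau>}"]) auto
  qed
  moreover have "integral {\<tau>..t} ?k \<le> integral {\<tau>..t} (\<lambda>s. (t - s) powr (-\<alpha>) * K)"
    using has_integral_mult_left[OF has_integral_powr_reflected[OF assms(2,4)], of K]
    by (intro integral_le int2) (auto intro!: mult_left_mono le)
  moreover have "integral {\<tau>..t} (\<lambda>s. (t - s) powr (-\<alpha>) * K) = K * (t - \<tau>) powr (1 - \<alpha>) / (1 - \<alpha>)"
    using integral_unique[OF has_integral_mult_left[OF has_integral_powr_reflected[OF assms(2,4)], of K]]
    by (simp add: mult.commute)
  moreover have "integral {0..t} ?k = integral {0..\<tau>} ?k + integral {\<tau>..t} ?k"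
    using Henstock_Kurzweil_Integration.integral_combine[OF assms(3,4) int] by simp
  ultimately show ?thesis by linarith
qed

text \<open>The derivative is taken from the left because the sign of \<open>w\<close> is known only
  up to \<open>t\<close>.\<close>

lemma powr_reflected_integral_derivative_nonpos:
  fixes \<alpha> t G :: real
  assumes \<alpha>: "0 \<le> \<alpha>" "\<alpha> < 1" and "0 < t" and cont: "continuous_on {0..t} w"
    and nonneg: "\<And>s. s \<in> {0..t} \<Longrightarrow> 0 \<le> w s" and w0: "w t = 0"
    and deriv: "(w has_real_derivative d) (at t)"
    and G: "((\<lambda>\<tau>. integral {0..\<tau>} (\<lambda>s. (\<tau> - s) powr (-\<alpha>) * w s)) has_real_derivative G)
      (at_left t)"
  shows "G \<le> 0"
proof -
  let ?W = "\<lambda>\<tau>. integral {0..\<tau>} (\<lambda>s. (\<tau> - s) powr (-\<alpha>) * w s)"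
  \<comment> \<open>Near \<open>t\<close> the difference quotients of \<open>w\<close> lie within 1
    of \<open>d\<close>, so \<open>K\<close> bounds their absolute value.\<close>
  define K where "K = \<bar>d\<bar> + 1"
  have "((\<lambda>s. (w s - w t) / (s - t)) \<longlongrightarrow> d) (at t)"
    using deriv by (simp add: has_field_derivative_iff)
  then have "\<forall>\<^sub>F s in at t. \<bar>(w s - w t) / (s - t) - d\<bar> < 1"
    using tendstoD[of _ d _ 1] by (simp add: dist_real_def)
  then obtain e where "e > 0" and e: "\<And>s. \<lbrakk>s \<noteq> t; dist s t < e\<rbrakk> \<Longrightarrow> \<bar>w s / (s - t) - d\<bar> < 1"
    by (auto simp: eventually_at w0)
  have lin: "w s \<le> K * (t - s)" if "t - e < s" "s \<le> t" for s
  proof (cases "s = t")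
    case False
    then have "- (w s / (s - t)) \<le> K"
      using e[of s] that by (auto simp: K_def dist_real_def)
    then show ?thesis using False that by (simp add: field_simps)
  qed (simp add: w0)
  have "((\<lambda>\<tau>. (?W \<tau> - ?W t) / (\<tau> - t)) \<longlongrightarrow> G) (at_left t)"
    using G by (simp add: has_field_derivative_iff)
  moreover have "((\<lambda>\<tau>. K * (t - \<tau>) powr (1 - \<alpha>) / (1 - \<alpha>)) \<longlongrightarrow> K * (t - t) powr (1 - \<alpha>) / (1 - \<alpha>))
      (at_left t)"
    \<comment> \<open>The base tends to 0, so continuity of \<open>powr\<close> there needs the
      positive exponent \<open>1 - \<alpha>\<close> and a nonnegative base, which holds to the left
      of \<open>t\<close>.\<close>
    using \<alpha> by (intro tendsto_intros tendsto_powr2) (auto intro!: eventually_at_leftI[of "t - 1"])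
  moreover have "\<forall>\<^sub>F \<tau> in at_left t. (?W \<tau> - ?W t) / (\<tau> - t) \<le> K * (t - \<tau>) powr (1 - \<alpha>) / (1 - \<alpha>)"
  proof (rule eventually_at_leftI[of "max 0 (t - e)"])
    fix \<tau> assume \<tau>: "\<tau> \<in> {max 0 (t - e)<..<t}"
    have "w s \<le> K * (t - \<tau>)" if "s \<in> {\<tau>..t}" for s
      using lin[of s] mult_left_mono[of "t - s" "t - \<tau>" K] that \<tau> by (auto simp: K_def)
    \<comment> \<open>The bound on \<open>w\<close> is itself of size \<open>t - \<tau>\<close>;
      this factor cancels the denominator of the difference quotient and leaves a power that tends
      to 0.\<close>
    then have "?W t - ?W \<tau> \<le> (K * (t - \<tau>)) * (t - \<tau>) powr (1 - \<alpha>) / (1 - \<alpha>)"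
      using \<alpha> \<tau> by (intro powr_reflected_integral_increment_le cont nonneg) auto
    then have "(?W t - ?W \<tau>) / (t - \<tau>) \<le> (K * (t - \<tau>)) * (t - \<tau>) powr (1 - \<alpha>) / (1 - \<alpha>) / (t - \<tau>)"
      using \<tau> by (intro divide_right_mono) auto
    also have "\<dots> = K * (t - \<tau>) powr (1 - \<alpha>) / (1 - \<alpha>)"
      using \<tau> by simp
    also have "(?W t - ?W \<tau>) / (t - \<tau>) = (?W \<tau> - ?W t) / (\<tau> - t)"
      using minus_divide_divide[of "?W t - ?W \<tau>" "t - \<tau>"] by simp
    finally show "(?W \<tau> - ?W t) / (\<tau> - t) \<le> K * (t - \<tau>) powr (1 - \<alpha>) / (1 - \<alpha>)" .
  qed (use \<open>e > 0\<close> \<open>0 < t\<close> in auto)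
  ultimately have "G \<le> K * (t - t) powr (1 - \<alpha>) / (1 - \<alpha>)"
    by (intro tendsto_le[OF trivial_limit_at_left_real])
  then show ?thesis by simp
qed

text \<open>Replacing \<open>f 0\<close> by \<open>f t\<close> in the integrand changes the integral
  by an explicit multiple of \<open>\<tau> powr (1 - \<alpha>)\<close>, whose derivative at
  \<open>t\<close> yields the right-hand side. What remains is the integral for the nonnegative
  function \<open>f s - f t\<close>.\<close>

lemma caputo_derivative_at_minimum:
  fixes \<alpha> t D :: real
  assumes \<alpha>: "0 \<le> \<alpha>" "\<alpha> < 1" and "0 < t" and cont: "continuous_on {0..t} f"
    and min: "\<And>s. s \<in> {0..t} \<Longrightarrow> f t \<le> f s"
    and deriv: "(f has_real_derivative d) (at t)"
    and D: "has_caputo_derivative \<alpha> f D t"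
  shows "D \<le> (f t - f 0) * t powr (-\<alpha>) / Gamma (1 - \<alpha>)"
proof -
  have \<Gamma>: "Gamma (1 - \<alpha>) > 0"
    using \<alpha> by (intro Gamma_real_pos) auto
  let ?I = "\<lambda>\<tau>. integral {0..\<tau>} (\<lambda>s. (\<tau> - s) powr (-\<alpha>) * (f s - f 0))"
  let ?W = "\<lambda>\<tau>. integral {0..\<tau>} (\<lambda>s. (\<tau> - s) powr (-\<alpha>) * (f s - f t))"
  let ?c = "f t - f 0"
  have "((\<lambda>\<tau>. 1 / Gamma (1 - \<alpha>) * ?I \<tau>) has_real_derivative D) (at_left t)"
    using D unfolding has_caputo_derivative_def by (rule has_field_derivative_at_within)
  from DERIV_cmult[OF this, of "Gamma (1 - \<alpha>)"]
  have I: "(?I has_real_derivative Gamma (1 - \<alpha>) * D) (at_left t)"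
    using \<Gamma> by simp
  have "((\<lambda>\<tau>. ?c * \<tau> powr (1 - \<alpha>) / (1 - \<alpha>)) has_real_derivative ?c * t powr (-\<alpha>)) (at_left t)"
    using \<alpha> DERIV_cdivide[OF DERIV_cmult[OF has_real_derivative_powr[OF \<open>0 < t\<close>, of "1 - \<alpha>"],
        of ?c], of "1 - \<alpha>"]
    by (auto intro!: has_field_derivative_at_within[of _ _ t])
  from DERIV_diff[OF I this]
  have "((\<lambda>\<tau>. ?I \<tau> - ?c * \<tau> powr (1 - \<alpha>) / (1 - \<alpha>)) has_real_derivative
      Gamma (1 - \<alpha>) * D - ?c * t powr (-\<alpha>)) (at_left t)" .
  moreover have W: "?I \<tau> - ?c * \<tau> powr (1 - \<alpha>) / (1 - \<alpha>) = ?W \<tau>" if "\<tau> \<in> {0..t}" for \<tau>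
  proof -
    have k: "((\<lambda>s. (\<tau> - s) powr (-\<alpha>)) has_integral \<tau> powr (1 - \<alpha>) / (1 - \<alpha>)) {0..\<tau>}"
      using has_integral_powr_reflected[OF \<alpha>(2), of 0 \<tau>] that by simp
    have "(\<lambda>s. (\<tau> - s) powr (-\<alpha>) * (f s - f t)) integrable_on {0..\<tau>}"
      using that \<alpha>
      by (intro integrable_powr_reflected_mult continuous_intros continuous_on_subset[OF cont]) auto
    from has_integral_add[OF integrable_integral[OF this] has_integral_mult_left[OF k, of ?c]]
    have "((\<lambda>s. (\<tau> - s) powr (-\<alpha>) * (f s - f 0)) has_integral
        (?W \<tau> + \<tau> powr (1 - \<alpha>) / (1 - \<alpha>) * ?c)) {0..\<tau>}"
      by (simp add: algebra_simps)
    then show ?thesis by (simp add: integral_unique)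
  qed
  moreover have "\<forall>\<^sub>F \<tau> in at_left t. ?I \<tau> - ?c * \<tau> powr (1 - \<alpha>) / (1 - \<alpha>) = ?W \<tau>"
    using \<open>0 < t\<close> by (intro eventually_at_leftI[of 0]) (auto intro!: W)
  \<comment> \<open>The identity \<open>W\<close> is known only up to \<open>t\<close>; for a left
    derivative it is enough to have it at \<open>t\<close> and just before.\<close>
  ultimately have "(?W has_real_derivative Gamma (1 - \<alpha>) * D - ?c * t powr (-\<alpha>)) (at_left t)"
    using W[of t] \<open>0 < t\<close> by (subst (asm) has_field_derivative_cong_eventually) auto
  moreover have "((\<lambda>s. f s - f t) has_real_derivative d) (at t)"
    using DERIV_diff[OF deriv DERIV_const[of "f t"]] by simp
  ultimately have "Gamma (1 - \<alpha>) * D - ?c * t powr (-\<alpha>) \<le> 0"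
    using \<open>0 < t\<close> min \<alpha> cont
    by (intro powr_reflected_integral_derivative_nonpos[where w = "\<lambda>s. f s - f t"]
        continuous_intros) auto
  then show ?thesis
    using \<Gamma> by (simp add: field_simps)
qed

lemma second_derivative_nonneg_at_minimum:
  fixes f f' :: "real \<Rightarrow> real"
  assumes "a < x" "x < b"
    and f': "\<And>y. y \<in> {a<..<b} \<Longrightarrow> (f has_real_derivative f' y) (at y)"
    and f'': "(f' has_real_derivative c) (at x)"
    and min: "\<And>y. y \<in> {a<..<b} \<Longrightarrow> f x \<le> f y"
  shows "f' x = 0" and "0 \<le> c"
proof -
  show 0: "f' x = 0"
  proof (rule DERIV_local_min)
    show "(f has_real_derivative f' x) (at x)" using assms by auto
    show "0 < min (x - a) (b - x)" using assms by auto
    show "\<forall>y. \<bar>x - y\<bar> < Orderings.min (x - a) (b - x) \<longrightarrow> f x \<le> f y"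
      by (auto intro!: min simp: abs_less_iff)
  qed
  show "0 \<le> c"
  proof (rule ccontr)
    assume "\<not> 0 \<le> c"
    then obtain e where "e > 0" and e: "\<And>h. \<lbrakk>0 < h; h < e\<rbrakk> \<Longrightarrow> f' (x + h) < f' x"
      using DERIV_neg_dec_right[OF f''] by auto
    \<comment> \<open>Halving keeps \<open>y\<close> strictly inside both \<open>b\<close> and the
      range where \<open>f'\<close> is below \<open>f' x = 0\<close>, so the mean value theorem
      gives \<open>f y < f x\<close>.\<close>
    define y where "y = x + Orderings.min e (b - x) / 2"
    have y: "x < y" "y < x + e" "y < b"
      using \<open>e > 0\<close> \<open>x < b\<close> by (auto simp: y_def min_def field_simps)
    obtain z where z: "x < z" "z < y" "f y - f x = (y - x) * f' z"
      using MVT2[OF y(1), of f f'] f' y \<open>a < x\<close> by auto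
    moreover have "f' z < 0"
      using e[of "z - x"] z y 0 by auto
    ultimately have "f y < f x"
      using y by (smt (verit) mult_pos_neg)
    then show False using min[of y] y \<open>a < x\<close> by auto
  qed
qed

theorem theorem6p1:
  fixes \<alpha> L T \<nu> :: real
    and u\<^sub>0 :: "real \<Rightarrow> real"
    and u :: "real \<Rightarrow> real \<Rightarrow> real"
  assumes "0 < \<alpha>" and "\<alpha> < 1" and "L > 0" and "T > 0" and "\<nu> > 0"
    and "continuous_on {0..L} u\<^sub>0"
    and "classical_solution_fractional_burgers \<alpha> \<nu> L T u\<^sub>0 u"
  shows "\<forall>x\<in>{0..L}. \<forall>t\<in>{0..<T}. ereal (u x t) \<ge> min_data L T u\<^sub>0 u"
proof (intro ballI, rule ccontr)
  fix x t assume x: "x \<in> {0..L}" and t: "t \<in> {0..<T}" and "\<not> min_data L T u\<^sub>0 u \<le> ereal (u x t)"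
  then have below: "ereal (u x t) < min_data L T u\<^sub>0 u" by simp
  note sol = assms(7)[unfolded classical_solution_fractional_burgers_def]
  have cont: "continuous_on ({0..L} \<times> {0..<T}) (\<lambda>(x, t). u x t)"
    and init: "\<And>x. x \<in> {0..L} \<Longrightarrow> u x 0 = u\<^sub>0 x"
    using sol by auto
  obtain ut ux uxx where
    ut: "\<And>x t. \<lbrakk>x \<in> {0<..<L}; t \<in> {0<..<T}\<rbrakk> \<Longrightarrow> ((\<lambda>s. u x s) has_real_derivative ut x t) (at t)" and
    ux: "\<And>x t. \<lbrakk>x \<in> {0<..<L}; t \<in> {0<..<T}\<rbrakk> \<Longrightarrow> ((\<lambda>y. u y t) has_real_derivative ux x t) (at x)" and
    uxx: "\<And>x t. \<lbrakk>x \<in> {0<..<L}; t \<in> {0<..<T}\<rbrakk> \<Longrightarrow> ((\<lambda>y. ux y t) has_real_derivative uxx x t) (at x)" and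
    eqn: "\<And>x t. \<lbrakk>x \<in> {0<..<L}; t \<in> {0<..<T}\<rbrakk> \<Longrightarrow>
      \<exists>D. has_caputo_derivative \<alpha> (\<lambda>s. u x s) D t \<and> D + u x t * ux x t = \<nu> * uxx x t"
    using sol by blast
  have data: "u x t < v" if "v \<in> (\<lambda>t. u 0 t) ` {0..<T} \<union> (\<lambda>t. u L t) ` {0..<T} \<union> u\<^sub>0 ` {0..L}" for v
  proof -
    have "min_data L T u\<^sub>0 u \<le> ereal v"
      unfolding min_data_def using that by (intro Inf_lower imageI)
    with below have "ereal (u x t) < ereal v" by (rule less_le_trans)
    then show ?thesis by simp
  qed
  \<comment> \<open>Stopping at \<open>t < T\<close> makes the rectangle compact. The minimum may
    lie on its top edge \<open>t0 = t\<close>, so only earlier times can be compared with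
    it.\<close>
  let ?R = "{0..L} \<times> {0..t}"
  have "continuous_on ?R (\<lambda>(x, t). u x t)"
    using t by (intro continuous_on_subset[OF cont]) auto
  moreover have "compact ?R" by (intro compact_Times) auto
  moreover have "(x, t) \<in> ?R" using x t by auto
  ultimately obtain x0 t0 where x0: "x0 \<in> {0..L}" and t0: "t0 \<in> {0..t}"
    and min: "\<And>y s. \<lbrakk>y \<in> {0..L}; s \<in> {0..t}\<rbrakk> \<Longrightarrow> u x0 t0 \<le> u y s"
    using continuous_attains_inf[of ?R "\<lambda>(x, t). u x t"] by fastforce
  have low: "u x0 t0 \<le> u x t" using min[of x t] x t by auto
  \<comment> \<open>The minimum is at most \<open>u x t\<close> and thus strictly below all data,
    which keeps it off the initial line and both lateral sides.\<close>
  have "t0 \<noteq> 0" using data[of "u\<^sub>0 x0"] init[OF x0] low x0 by auto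
  moreover have "x0 \<noteq> 0" using data[of "u 0 t0"] low t0 t by auto
  moreover have "x0 \<noteq> L" using data[of "u L t0"] low t0 t by auto
  ultimately have x0': "x0 \<in> {0<..<L}" and t0': "t0 \<in> {0<..<T}"
    using x0 t0 t by auto
  have min': "u x0 t0 \<le> u y t0" if "y \<in> {0<..<L}" for y
    using that t0 by (intro min) auto
  have "ux x0 t0 = 0" "0 \<le> uxx x0 t0"
    using second_derivative_nonneg_at_minimum[of 0 x0 L "\<lambda>y. u y t0" "\<lambda>y. ux y t0",
        OF _ _ ux[OF _ t0'] uxx[OF x0' t0'] min'] x0'
    by simp_all
  moreover obtain D where D: "has_caputo_derivative \<alpha> (\<lambda>s. u x0 s) D t0"
    and "D + u x0 t0 * ux x0 t0 = \<nu> * uxx x0 t0"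
    using eqn[OF x0' t0'] by blast
  \<comment> \<open>The nonlinear term drops out because \<open>ux x0 t0 = 0\<close>, whatever the
    sign of \<open>u x0 t0\<close>.\<close>
  ultimately have "0 \<le> D" using \<open>\<nu> > 0\<close> by simp
  moreover have "D \<le> (u x0 t0 - u x0 0) * t0 powr (-\<alpha>) / Gamma (1 - \<alpha>)"
  proof (rule caputo_derivative_at_minimum[OF _ _ _ _ _ _ D])
    have "continuous_on {0..t0} ((\<lambda>(x, t). u x t) \<circ> (\<lambda>s. (x0, s)))"
      using x0 t0 t
      by (intro continuous_on_compose continuous_intros continuous_on_subset[OF cont]) auto
    then show "continuous_on {0..t0} (u x0)" by (simp add: o_def)
    show "(u x0 has_real_derivative ut x0 t0) (at t0)" using ut[OF x0' t0'] .
  qed (use assms x0 t0 t0' min in auto)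
  moreover have "(u x0 t0 - u x0 0) * t0 powr (-\<alpha>) / Gamma (1 - \<alpha>) < 0"
  proof -
    have "u x0 t0 < u x0 0" using data[of "u\<^sub>0 x0"] init[OF x0] low x0 by auto
    moreover have "Gamma (1 - \<alpha>) > 0" using assms by (intro Gamma_real_pos) auto
    ultimately show ?thesis
      using t0' by (intro divide_neg_pos mult_neg_pos) auto
  qed
  ultimately show False by linarith
qed

end
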